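(* Suppose that $\ker(B)\cap V_0=\{0\}$ and let $\phi$ be an N-function such that $\phi'(t)/t\le\phi'(T)/T$ for all $0<t\le T$. Let $\delta=[\delta_-,\delta_+]\subset(0,\infty)$ be some relaxation interval and let $$u=\operatorname{argmin}_{v\in V_0}J(v+g),\qquad u_\delta=\operatorname{argmin}_{v\in V_0}J_\delta(v+g),\qquad \sigma=\operatorname{argmin}_{\tau\in\Sigma_f}J^*(\tau).$$ Set $u_{\delta,g}:=u_\delta+g$ and $u_g:=u+g$. Then $$0\le J_\delta(u_g)-J_\delta(u_{\delta,g})\le\sum_{\alpha\in\mathcal{A}}w_\alpha\,e^*_\delta(w_\alpha^{-1}|\sigma_\alpha|)-\sum_{\alpha\in\mathcal{A}}w_\alpha\,e_\delta(|(Bu_g)_\alpha|).$$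
   Context: N-function: $\phi:[0,\infty)\to[0,\infty)$ is an N-function if it is continuous and convex and there is a right-continuous, non-decreasing $\phi':[0,\infty)\to[0,\infty)$ with $\phi'(0)=0$, $\phi'(t)>0$ for $t>0$, $\lim_{t\to\infty}\phi'(t)=\infty$ and $\phi(t)=\int_0^t\phi'(s)\,ds$. Fenchel conjugate: $\phi^*(r):=\sup_{s\ge0}(rs-\phi(s))$, $r\ge0$. Setting: $M,N\in\mathbb{N}$, $\mathcal{A}=\{1,\dots,M\}$, $B:\mathbb{R}^N\to\mathbb{R}^M$ linear, weights $w_\alpha>0$, $f\in\mathbb{R}^N$, $C\in\mathbb{R}^{m_c\times N}$, $d\in\mathbb{R}^{m_c}$ with $m_c\in\mathbb{N}_0$, $g\in\mathbb{R}^N$ with $Cg=d$, $V_0:=\ker(C)$, $$J(v):=\sum_{\alpha\in\mathcal{A}}w_\alpha\phi(|(Bv)_\alpha|)-f\cdot v,\qquad J^*(\tau):=\sum_{\alpha\in\mathcal{A}}w_\alpha\phi^*(w_\alpha^{-1}|\tau_\alpha|)-\tau^\top Bg,$$ for $v\in\mathbb{R}^N$, $\tau\in\mathbb{R}^M$, and $\Sigma_f:=\{\tau\in\mathbb{R}^M:\tau^\top Bv=f\cdot v\ \text{for all }v\in V_0\}$. Regularization: for $\delta=[\delta_-,\delta_+]$, $0<\delta_-\le\delta_+<\infty$, $$\phi_\delta(t):=\begin{cases}\frac{\phi'(\delta_-)}{2\delta_-}t^2+\phi(\delta_-)-\frac{\delta_-}{2}\phi'(\delta_-),&t\in[0,\delta_-),\\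 \phi(t),&t\in[\delta_-,\delta_+],\\ \frac{\phi'(\delta_+)}{2\delta_+}t^2+\phi(\delta_+)-\frac{\delta_+}{2}\phi'(\delta_+),&t\in(\delta_+,\infty),\end{cases}$$ $$\phi^*_\delta(r)=\begin{cases}\frac{\delta_-}{2\phi'(\delta_-)}r^2-\phi(\delta_-)+\frac{\delta_-}{2}\phi'(\delta_-),&r\in[0,\phi'(\delta_-)),\\ \phi^*(r),&r\in[\phi'(\delta_-),\phi'(\delta_+)],\\ \frac{\delta_+}{2\phi'(\delta_+)}r^2-\phi(\delta_+)+\frac{\delta_+}{2}\phi'(\delta_+),&r\in(\phi'(\delta_+),\infty),\end{cases}$$ where $\phi_\delta^*$ is the conjugate $\sup_{s\ge0}(rs-\phi_\delta(s))$. Set $J_\delta(v):=\sum_{\alpha\in\mathcal{A}}w_\alpha\phi_\delta(|(Bv)_\alpha|)-f\cdot v$, and the pointwise regularization errors $e_\delta(t):=\phi(t)-\phi_\delta(t)$ and $e^*_\delta(t):=\phi^*_\delta(t)-\phi^*(t)$ for $t\ge0$. *)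

theory Defs
  imports "HOL-Analysis.Analysis"
begin

text \<open>
  Functions on \<open>[0,\<infinity>)\<close> are modelled as total functions on the reals; their values at negative
  arguments are unconstrained and never used. The right-continuous density \<open>\<phi>'\<close> of an N-function
  \<open>\<phi>\<close> is uniquely determined on \<open>[0,\<infinity>)\<close> (it is the right derivative), so it is carried along
  as a second argument.
\<close>

definition N_function :: "(real \<Rightarrow> real) \<Rightarrow> (real \<Rightarrow> real) \<Rightarrow> bool" where
  "N_function \<phi> \<phi>' \<longleftrightarrow>
     (\<forall>t\<ge>0. 0 \<le> \<phi> t) \<and> continuous_on {0..} \<phi> \<and> convex_on {0..} \<phi> \<and>
     (\<forall>t\<ge>0. 0 \<le> \<phi>' t) \<and> (\<forall>t\<ge>0. continuous (at_right t) \<phi>') \<and> mono_on {0..} \<phi>' \<and>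
     \<phi>' 0 = 0 \<and> (\<forall>t>0. 0 < \<phi>' t) \<and> filterlim \<phi>' at_top at_top \<and>
     (\<forall>t\<ge>0. (\<phi>' has_integral \<phi> t) {0..t})"

text \<open>
  The supremum is taken in the reals. It is over a set that is bounded above for N-functions, and
  for their regularizations below, since these grow superlinearly.
\<close>

definition fenchel_conj :: "(real \<Rightarrow> real) \<Rightarrow> real \<Rightarrow> real" where
  "fenchel_conj \<phi> r = (SUP s\<in>{0..}. r * s - \<phi> s)"

definition regularize ::
    "(real \<Rightarrow> real) \<Rightarrow> (real \<Rightarrow> real) \<Rightarrow> real \<Rightarrow> real \<Rightarrow> real \<Rightarrow> real" where
  "regularize \<phi> \<phi>' dm dp t =
     (if t < dm then \<phi>' dm / (2 * dm) * t\<^sup>2 + \<phi> dm - dm / 2 * \<phi>' dm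
      else if t \<le> dp then \<phi> t
      else \<phi>' dp / (2 * dp) * t\<^sup>2 + \<phi> dp - dp / 2 * \<phi>' dp)"

definition reg_error ::
    "(real \<Rightarrow> real) \<Rightarrow> (real \<Rightarrow> real) \<Rightarrow> real \<Rightarrow> real \<Rightarrow> real \<Rightarrow> real" where
  "reg_error \<phi> \<phi>' dm dp t = \<phi> t - regularize \<phi> \<phi>' dm dp t"

definition reg_error_conj ::
    "(real \<Rightarrow> real) \<Rightarrow> (real \<Rightarrow> real) \<Rightarrow> real \<Rightarrow> real \<Rightarrow> real \<Rightarrow> real" where
  "reg_error_conj \<phi> \<phi>' dm dp t =
     fenchel_conj (regularize \<phi> \<phi>' dm dp) t - fenchel_conj \<phi> t"

definition energy ::
    "(real \<Rightarrow> real) \<Rightarrow> ('m \<Rightarrow> real) \<Rightarrow> (real^'n \<Rightarrow> real^'m) \<Rightarrow> real^'n \<Rightarrow> real^'n \<Rightarrow> real" where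
  "energy \<phi> w B f v = (\<Sum>\<alpha>\<in>UNIV. w \<alpha> * \<phi> \<bar>B v $ \<alpha>\<bar>) - f \<bullet> v"

definition dual_energy ::
    "(real \<Rightarrow> real) \<Rightarrow> ('m \<Rightarrow> real) \<Rightarrow> (real^'n \<Rightarrow> real^'m) \<Rightarrow> real^'n \<Rightarrow> real^'m \<Rightarrow> real" where
  "dual_energy \<phi> w B g \<tau> =
     (\<Sum>\<alpha>\<in>UNIV. w \<alpha> * fenchel_conj \<phi> (inverse (w \<alpha>) * \<bar>\<tau> $ \<alpha>\<bar>)) - \<tau> \<bullet> B g"

text \<open>
  The constraint matrix has \<open>mc\<close> rows \<open>C 0, \<dots>, C (mc - 1)\<close>. A natural number is used in place of
  a finite index type because \<open>mc = 0\<close> (no constraints) has to be allowed.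
\<close>

definition constraint_kernel :: "nat \<Rightarrow> (nat \<Rightarrow> real^'n) \<Rightarrow> (real^'n) set" where
  "constraint_kernel mc C = {v. \<forall>i<mc. C i \<bullet> v = 0}"

definition admissible_stresses ::
    "(real^'n \<Rightarrow> real^'m) \<Rightarrow> real^'n \<Rightarrow> (real^'n) set \<Rightarrow> (real^'m) set" where
  "admissible_stresses B f V = {\<tau>. \<forall>v\<in>V. \<tau> \<bullet> B v = f \<bullet> v}"

end

theory Submission
  imports Defs
begin

text \<open>
  Every \<open>v \<in> V\<^sub>0\<close> and \<open>\<tau> \<in> \<Sigma>\<^sub>f\<close> satisfy the weak duality inequality
  \<open>J\<^sub>\<delta>(v + g) + J\<^sub>\<delta>\<^sup>*(\<tau>) \<ge> - f \<bullet> g\<close>, whereas the unrelaxed minimizers satisfy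
  \<open>J(u + g) + J\<^sup>*(\<sigma>) \<le> - f \<bullet> g\<close>. Subtracting the two, with \<open>v = u\<^sub>\<delta>\<close> and \<open>\<tau> = \<sigma>\<close>, bounds
  \<open>J\<^sub>\<delta>(u + g) - J\<^sub>\<delta>(u\<^sub>\<delta> + g)\<close> by the regularization errors. The second inequality is obtained
  by separating the strict epigraph of \<open>z \<mapsto> \<Sum>\<^sub>\<alpha> w\<^sub>\<alpha> \<phi>(|z\<^sub>\<alpha>|)\<close> from the graph of the
  linear term over \<open>B(u + g) + B V\<^sub>0\<close>, which touches it at \<open>B(u + g)\<close>.
\<close>

section \<open>Separation of convex sets and constrained subgradients\<close>

lemma subgradient_of_constrained_minimum:
  fixes G :: "'a::euclidean_space \<Rightarrow> real"
    and L :: "'v::real_vector \<Rightarrow> 'a"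
    and l :: "'v \<Rightarrow> real"
  assumes G: "convex_on UNIV G" and L: "linear L" and l: "linear l" and V: "subspace V"
    and min: "\<And>v. v \<in> V \<Longrightarrow> G z0 + l v \<le> G (z0 + L v)"
  obtains \<tau> where "\<And>v. v \<in> V \<Longrightarrow> \<tau> \<bullet> L v = l v"
    and "\<And>z. G z0 + \<tau> \<bullet> (z - z0) \<le> G z"
proof -
  define h where "h v = (L v, l v)" for v
  have h: "linear h"
    unfolding h_def using L l by (auto simp: linear_iff)
  \<comment> \<open>\<open>S\<close> consists of the points \<open>(z0 + L v, G z0 + l v)\<close>,
    written as a translated linear image so that its convexity is immediate. Taking the strict
    epigraph for \<open>T\<close> keeps the two sets disjoint although \<open>S\<close> contains
    \<open>(z0, G z0)\<close>.\<close>
  define S where "S = (\<lambda>x. (z0, G z0) + x) ` h ` V"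
  define T where "T = {(z, s). G z < s}"
  have "convex S"
    unfolding S_def
    by (intro convex_translation convex_linear_image h subspace_imp_convex V)
  moreover have "convex T"
  proof -
    show ?thesis
      unfolding convex_alt
    proof clarify
      fix z s z' s' and t :: real
      assume A: "(z, s) \<in> T" "(z', s') \<in> T" "0 \<le> t" "t \<le> 1"
      have "G ((1 - t) *\<^sub>R z + t *\<^sub>R z') \<le> (1 - t) * G z + t * G z'"
        using convex_onD[OF G A(3,4)] by simp
      \<comment> \<open>For \<open>t > 0\<close> the second summand supplies the strictness; for
        \<open>t = 0\<close> it has to come from the first.\<close>
      also have "\<dots> < (1 - t) * s + t * s'"
      proof (cases "t = 0")
        case False
        then have "t * G z' < t * s'" using A by (auto simp: T_def)
        moreover have "(1 - t) * G z \<le> (1 - t) * s"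
          using A by (intro mult_left_mono) (auto simp: T_def)
        ultimately show ?thesis by simp
      qed (use A in \<open>auto simp: T_def\<close>)
      finally show "(1 - t) *\<^sub>R (z, s) + t *\<^sub>R (z', s') \<in> T"
        by (simp add: T_def)
    qed
  qed
  moreover have "S \<noteq> {}" "T \<noteq> {}"
    using V subspace_0 by (auto simp: S_def T_def intro: lt_ex gt_ex)
  moreover have "S \<inter> T = {}"
    using min by (fastforce simp: S_def T_def h_def)
  ultimately obtain n b where n: "n \<noteq> 0" and nS: "\<And>x. x \<in> S \<Longrightarrow> n \<bullet> x \<le> b"
    and nT: "\<And>x. x \<in> T \<Longrightarrow> b \<le> n \<bullet> x"
    using separating_hyperplane_sets[of S T] by blast
  obtain a \<rho> where n_eq: "n = (a, \<rho>)" by (cases n)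
  have S0: "a \<bullet> (z0 + L v) + \<rho> * (G z0 + l v) \<le> b" if "v \<in> V" for v
  proof -
    have "(z0 + L v, G z0 + l v) \<in> S"
      unfolding S_def image_image using that by (rule rev_image_eqI) (simp add: h_def)
    then show ?thesis using nS by (fastforce simp: n_eq inner_prod_def)
  qed
  have T0: "b \<le> a \<bullet> z + \<rho> * s" if "G z < s" for z s
    using nT[of "(z, s)"] that by (auto simp: T_def n_eq inner_prod_def)
  have base: "a \<bullet> z0 + \<rho> * G z0 \<le> b"
    using S0[OF subspace_0[OF V]] L l by (simp add: linear_0)
  have "\<rho> \<ge> 0"
    using T0[of z0 "G z0 + 1"] base by (simp add: algebra_simps)
  \<comment> \<open>The hyperplane cannot be vertical because \<open>G\<close> is finite everywhere:
    \<open>T\<close> has points above \<open>z0 - a\<close>, and for \<rho> = 0 these force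
    \<open>a = 0\<close>, hence \<open>n = 0\<close>.\<close>
  moreover have "\<rho> \<noteq> 0"
  proof
    assume "\<rho> = 0"
    then have "a \<bullet> a \<le> 0"
      using T0[of "z0 - a" "G (z0 - a) + 1"] base by (simp add: inner_diff_right)
    then have "a = 0" by (metis inner_gt_zero_iff not_less)
    with \<open>\<rho> = 0\<close> n n_eq show False by (simp add: zero_prod_def)
  qed
  ultimately have \<rho>: "\<rho> > 0" by simp
  \<comment> \<open>The bound passes from the strict to the closed epigraph by letting the excess
    height \<open>e / \<rho>\<close> tend to zero.\<close>
  have T1: "b \<le> a \<bullet> z + \<rho> * G z" for z
  proof (rule field_le_epsilon)
    fix e :: real assume "e > 0"
    then show "b \<le> a \<bullet> z + \<rho> * G z + e"
      using T0[of z "G z + e / \<rho>"] \<rho> by (simp add: algebra_simps)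
  qed
  have le: "a \<bullet> L v + \<rho> * l v \<le> 0" if "v \<in> V" for v
    using S0[OF that] T1[of z0] by (simp add: algebra_simps)
  show thesis
  proof (rule that[of "- (1 / \<rho>) *\<^sub>R a"])
    fix v assume v: "v \<in> V"
    \<comment> \<open>A linear functional that is nonpositive on a subspace vanishes there: test it
      at \<open>v\<close> and at \<open>- v\<close>.\<close>
    have "a \<bullet> L v + \<rho> * l v = 0"
      using le[OF v] le[OF subspace_neg[OF V v]] L l by (simp add: linear_neg)
    then show "(- (1 / \<rho>) *\<^sub>R a) \<bullet> L v = l v"
      using \<rho> by (simp add: field_simps)
  next
    fix z
    have "a \<bullet> z0 + \<rho> * G z0 \<le> a \<bullet> z + \<rho> * G z"
      using base T1[of z] by simp
    then have "\<rho> * (G z0 + (- (1 / \<rho>) *\<^sub>R a) \<bullet> (z - z0)) \<le> \<rho> * G z"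
      using \<rho> by (simp add: algebra_simps)
    then show "G z0 + (- (1 / \<rho>) *\<^sub>R a) \<bullet> (z - z0) \<le> G z"
      using \<rho> by simp
  qed
qed

section \<open>Convexity of the weighted energy density\<close>

lemma N_function_mono:
  assumes "N_function \<phi> \<phi>'" "0 \<le> s" "s \<le> t"
  shows "\<phi> s \<le> \<phi> t"
proof (rule has_integral_subset_le)
  show "{0..s} \<subseteq> {0..t}" using assms by simp
  show "(\<phi>' has_integral \<phi> s) {0..s}" "(\<phi>' has_integral \<phi> t) {0..t}" "\<forall>x\<in>{0..t}. 0 \<le> \<phi>' x"
    using assms by (auto simp: N_function_def)
qed

text \<open>Composition with the absolute value keeps convexity because \<phi> is nondecreasing on
  the half-line: the triangle inequality is applied inside \<phi> before convexity.\<close>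

lemma N_function_convex_abs:
  assumes "N_function \<phi> \<phi>'"
  shows "convex_on UNIV (\<lambda>x. \<phi> \<bar>x\<bar>)"
proof (rule convex_onI)
  fix t x y :: real assume t: "0 < t" "t < 1"
  have cvx: "convex_on {0..} \<phi>" using assms by (simp add: N_function_def)
  have "\<bar>(1 - t) * x + t * y\<bar> \<le> (1 - t) * \<bar>x\<bar> + t * \<bar>y\<bar>"
    using abs_triangle_ineq[of "(1 - t) * x" "t * y"] t by (simp add: abs_mult)
  then have "\<phi> \<bar>(1 - t) * x + t * y\<bar> \<le> \<phi> ((1 - t) * \<bar>x\<bar> + t * \<bar>y\<bar>)"
    by (intro N_function_mono[OF assms]) auto
  also have "\<dots> \<le> (1 - t) * \<phi> \<bar>x\<bar> + t * \<phi> \<bar>y\<bar>"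
    using convex_onD[OF cvx, of t "\<bar>x\<bar>" "\<bar>y\<bar>"] t by simp
  finally show "\<phi> \<bar>(1 - t) *\<^sub>R x + t *\<^sub>R y\<bar> \<le> (1 - t) * \<phi> \<bar>x\<bar> + t * \<phi> \<bar>y\<bar>"
    by simp
qed simp

lemma convex_on_weighted_components:
  fixes w :: "'m::finite \<Rightarrow> real"
  assumes "convex_on UNIV \<psi>" "\<And>\<alpha>. 0 \<le> w \<alpha>"
  shows "convex_on UNIV (\<lambda>z::real^'m. \<Sum>\<alpha>\<in>UNIV. w \<alpha> * \<psi> (z $ \<alpha>))"
proof (rule convex_onI)
  fix t :: real and x y :: "real^'m" assume t: "0 < t" "t < 1"
  have "w \<alpha> * \<psi> (((1 - t) *\<^sub>R x + t *\<^sub>R y) $ \<alpha>)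
      \<le> w \<alpha> * ((1 - t) * \<psi> (x $ \<alpha>) + t * \<psi> (y $ \<alpha>))" for \<alpha>
    using convex_onD[OF assms(1), of t "x $ \<alpha>" "y $ \<alpha>"] t assms(2)
    by (intro mult_left_mono) auto
  then show "(\<Sum>\<alpha>\<in>UNIV. w \<alpha> * \<psi> (((1 - t) *\<^sub>R x + t *\<^sub>R y) $ \<alpha>))
      \<le> (1 - t) * (\<Sum>\<alpha>\<in>UNIV. w \<alpha> * \<psi> (x $ \<alpha>)) + t * (\<Sum>\<alpha>\<in>UNIV. w \<alpha> * \<psi> (y $ \<alpha>))"
    unfolding sum_distrib_left sum.distrib[symmetric]
    by (intro sum_mono) (simp add: algebra_simps)
qed simp

section \<open>Componentwise subgradients and conjugates\<close>

lemma fenchel_conj_le: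
  assumes "\<And>s. 0 \<le> s \<Longrightarrow> r * s - \<phi> s \<le> K"
  shows "fenchel_conj \<phi> r \<le> K"
  unfolding fenchel_conj_def using assms by (intro cSUP_least) auto

text \<open>The sum is separable, so testing with a point that differs from \<open>z0\<close> only
  in component \<alpha> cancels all other summands.\<close>

lemma subgradient_weighted_components:
  fixes w :: "'m::finite \<Rightarrow> real" and z0 \<tau> :: "real^'m"
  assumes "\<And>z. (\<Sum>\<alpha>\<in>UNIV. w \<alpha> * \<psi> (z0 $ \<alpha>)) + \<tau> \<bullet> (z - z0) \<le> (\<Sum>\<alpha>\<in>UNIV. w \<alpha> * \<psi> (z $ \<alpha>))"
  shows "w \<alpha> * \<psi> (z0 $ \<alpha>) + \<tau> $ \<alpha> * (x - z0 $ \<alpha>) \<le> w \<alpha> * \<psi> x"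
proof -
  define z where "z = z0 + axis \<alpha> (x - z0 $ \<alpha>)"
  have eq: "z $ \<beta> = (if \<beta> = \<alpha> then x else z0 $ \<beta>)" for \<beta>
    by (simp add: z_def axis_def)
  have "(\<Sum>\<beta>\<in>UNIV. w \<beta> * \<psi> (z $ \<beta>)) = w \<alpha> * \<psi> x + (\<Sum>\<beta>\<in>UNIV - {\<alpha>}. w \<beta> * \<psi> (z0 $ \<beta>))"
    by (subst sum.remove[of _ \<alpha>]) (auto simp: eq intro: sum.cong)
  moreover have "(\<Sum>\<beta>\<in>UNIV. w \<beta> * \<psi> (z0 $ \<beta>))
      = w \<alpha> * \<psi> (z0 $ \<alpha>) + (\<Sum>\<beta>\<in>UNIV - {\<alpha>}. w \<beta> * \<psi> (z0 $ \<beta>))"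
    by (subst sum.remove[of _ \<alpha>]) auto
  moreover have "\<tau> \<bullet> (z - z0) = \<tau> $ \<alpha> * (x - z0 $ \<alpha>)"
    by (simp add: z_def inner_axis)
  ultimately show ?thesis using assms[of z] by simp
qed

text \<open>This is the nontrivial half of the equality case in the Fenchel-Young inequality: the
  subgradient condition says that \<open>x0\<close> maximizes
  \<open>t * x - w * \<phi> \<bar>x\<bar>\<close>, whose supremum over \<open>x\<close> is
  \<open>w\<close> times the conjugate at \<open>\<bar>t\<bar> / w\<close>.\<close>

lemma weighted_fenchel_conj_le:
  assumes w: "w > 0"
    and sub: "\<And>x. w * \<phi> \<bar>x0\<bar> + t * (x - x0) \<le> w * \<phi> \<bar>x\<bar>"
  shows "w * fenchel_conj \<phi> (inverse w * \<bar>t\<bar>) \<le> t * x0 - w * \<phi> \<bar>x0\<bar>"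
proof -
  have "fenchel_conj \<phi> (inverse w * \<bar>t\<bar>) \<le> (t * x0 - w * \<phi> \<bar>x0\<bar>) / w"
  proof (rule fenchel_conj_le)
    fix s :: real assume "0 \<le> s"
    \<comment> \<open>Giving \<open>x\<close> the sign of \<open>t\<close> turns
      \<open>\<bar>t\<bar> * s\<close> into \<open>t * x\<close>, so the half-line supremum is
      tested on the whole line.\<close>
    define x where "x = (if t \<ge> 0 then s else - s)"
    have "\<bar>x\<bar> = s" "t * x = \<bar>t\<bar> * s"
      using \<open>0 \<le> s\<close> by (auto simp: x_def)
    then have "\<bar>t\<bar> * s - w * \<phi> s \<le> t * x0 - w * \<phi> \<bar>x0\<bar>"
      using sub[of x] by (simp add: algebra_simps)
    also have "\<bar>t\<bar> * s - w * \<phi> s = w * (inverse w * \<bar>t\<bar> * s - \<phi> s)"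
      using w by (simp add: algebra_simps)
    finally show "inverse w * \<bar>t\<bar> * s - \<phi> s \<le> (t * x0 - w * \<phi> \<bar>x0\<bar>) / w"
      using w by (simp add: pos_le_divide_eq mult.commute)
  qed
  then show ?thesis using w by (simp add: field_simps)
qed

section \<open>Duality between the primal and dual energies\<close>

lemma subspace_constraint_kernel: "subspace (constraint_kernel mc C)"
  by (auto simp: subspace_def constraint_kernel_def inner_add_right)

text \<open>The subgradient \<tau> at \<open>B (u + g)\<close> that represents the load on
  \<open>V\<close> is an admissible stress, and its dual energy already satisfies the bound.
  Minimality of \<sigma> then transfers the bound to \<sigma>.\<close>

lemma strong_duality:
  fixes B :: "real^'n \<Rightarrow> real^'m"
  assumes B: "linear B" and w: "\<And>\<alpha>. w \<alpha> > 0" and V: "subspace V"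
    and N: "N_function \<phi> \<phi>'"
    and u: "is_arg_min (\<lambda>v. energy \<phi> w B f (v + g)) (\<lambda>v. v \<in> V) u"
    and \<sigma>: "is_arg_min (dual_energy \<phi> w B g) (\<lambda>\<tau>. \<tau> \<in> admissible_stresses B f V) \<sigma>"
  shows "energy \<phi> w B f (u + g) + dual_energy \<phi> w B g \<sigma> \<le> - (f \<bullet> g)"
proof -
  have uV: "u \<in> V" using u by (simp add: is_arg_min_def)
  define G where "G z = (\<Sum>\<alpha>\<in>UNIV. w \<alpha> * \<phi> \<bar>z $ \<alpha>\<bar>)" for z :: "real^'m"
  define z0 where "z0 = B (u + g)"
  have convex: "convex_on UNIV G"
    unfolding G_def
    using convex_on_weighted_components[OF N_function_convex_abs[OF N]] w less_imp_le by blast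
  have min: "G z0 + f \<bullet> v \<le> G (z0 + B v)" if "v \<in> V" for v
  proof -
    have "energy \<phi> w B f (u + g) \<le> energy \<phi> w B f (u + v + g)"
      using u subspace_add[OF V uV that] by (auto simp: is_arg_min_linorder)
    moreover have "B (u + v + g) = z0 + B v"
      using B by (simp add: z0_def linear_add)
    ultimately show ?thesis
      by (simp add: energy_def G_def z0_def inner_add_right)
  qed
  obtain \<tau> where adm: "\<And>v. v \<in> V \<Longrightarrow> \<tau> \<bullet> B v = f \<bullet> v"
    and sub: "\<And>z. G z0 + \<tau> \<bullet> (z - z0) \<le> G z"
    using subgradient_of_constrained_minimum[where l = "\<lambda>v. f \<bullet> v", OF convex B _ V min]
    by (metis bounded_linear.linear bounded_linear_inner_right)
  have "(\<Sum>\<alpha>\<in>UNIV. w \<alpha> * fenchel_conj \<phi> (inverse (w \<alpha>) * \<bar>\<tau> $ \<alpha>\<bar>))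
      \<le> (\<Sum>\<alpha>\<in>UNIV. \<tau> $ \<alpha> * z0 $ \<alpha> - w \<alpha> * \<phi> \<bar>z0 $ \<alpha>\<bar>)"
    using subgradient_weighted_components[of w "\<lambda>x. \<phi> \<bar>x\<bar>", OF sub[unfolded G_def]]
    by (intro sum_mono weighted_fenchel_conj_le w)
  also have "\<dots> = \<tau> \<bullet> z0 - G z0"
    by (simp add: sum_subtractf G_def inner_vec_def)
  \<comment> \<open>The boundary term \<open>\<tau> \<bullet> B g\<close> in the dual energy cancels
    the \<open>g\<close> part of \<open>\<tau> \<bullet> z0\<close>; admissibility later replaces
    \<open>\<tau> \<bullet> B u\<close> by \<open>f \<bullet> u\<close>.\<close>
  finally have "dual_energy \<phi> w B g \<tau> \<le> \<tau> \<bullet> B u - G z0"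
    using B by (simp add: dual_energy_def z0_def linear_add inner_add_right)
  moreover have "dual_energy \<phi> w B g \<sigma> \<le> dual_energy \<phi> w B g \<tau>"
    using \<sigma> adm by (auto simp: is_arg_min_linorder admissible_stresses_def)
  ultimately show ?thesis
    using adm[OF uV] by (simp add: energy_def G_def z0_def inner_add_right)
qed

text \<open>Sum the weighted Fenchel-Young inequality over the components and use admissibility of
  \<tau>. The boundedness assumption makes the real supremum in \<open>fenchel_conj\<close> a
  genuine upper bound. The density \<psi> is general so that the relaxed one can be
  inserted.\<close>

lemma weak_duality:
  fixes B :: "real^'n \<Rightarrow> real^'m"
  assumes B: "linear B" and w: "\<And>\<alpha>. w \<alpha> > 0"
    and bdd: "\<And>r. bdd_above ((\<lambda>s. r * s - \<psi> s) ` {0..})"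
    and v: "v \<in> V" and \<tau>: "\<tau> \<in> admissible_stresses B f V"
  shows "- (f \<bullet> g) \<le> energy \<psi> w B f (v + g) + dual_energy \<psi> w B g \<tau>"
proof -
  define z where "z = B (v + g)"
  have "\<tau> $ \<alpha> * z $ \<alpha>
      \<le> w \<alpha> * \<psi> \<bar>z $ \<alpha>\<bar> + w \<alpha> * fenchel_conj \<psi> (inverse (w \<alpha>) * \<bar>\<tau> $ \<alpha>\<bar>)" for \<alpha>
  proof -
    have "inverse (w \<alpha>) * \<bar>\<tau> $ \<alpha>\<bar> * \<bar>z $ \<alpha>\<bar> - \<psi> \<bar>z $ \<alpha>\<bar> \<le> fenchel_conj \<psi> (inverse (w \<alpha>) * \<bar>\<tau> $ \<alpha>\<bar>)"
      unfolding fenchel_conj_def by (rule cSUP_upper[OF _ bdd]) simp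
    then have "w \<alpha> * (inverse (w \<alpha>) * \<bar>\<tau> $ \<alpha>\<bar> * \<bar>z $ \<alpha>\<bar> - \<psi> \<bar>z $ \<alpha>\<bar>)
        \<le> w \<alpha> * fenchel_conj \<psi> (inverse (w \<alpha>) * \<bar>\<tau> $ \<alpha>\<bar>)"
      using w[of \<alpha>] by (intro mult_left_mono) auto
    moreover have "w \<alpha> * (inverse (w \<alpha>) * \<bar>\<tau> $ \<alpha>\<bar> * \<bar>z $ \<alpha>\<bar> - \<psi> \<bar>z $ \<alpha>\<bar>)
        = \<bar>\<tau> $ \<alpha>\<bar> * \<bar>z $ \<alpha>\<bar> - w \<alpha> * \<psi> \<bar>z $ \<alpha>\<bar>"
      using w[of \<alpha>] by (simp add: field_simps)
    moreover have "\<tau> $ \<alpha> * z $ \<alpha> \<le> \<bar>\<tau> $ \<alpha>\<bar> * \<bar>z $ \<alpha>\<bar>"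
      by (metis abs_ge_self abs_mult)
    ultimately show ?thesis by linarith
  qed
  then have "\<tau> \<bullet> z \<le> (\<Sum>\<alpha>\<in>UNIV. w \<alpha> * \<psi> \<bar>z $ \<alpha>\<bar>)
      + (\<Sum>\<alpha>\<in>UNIV. w \<alpha> * fenchel_conj \<psi> (inverse (w \<alpha>) * \<bar>\<tau> $ \<alpha>\<bar>))"
    by (simp add: inner_vec_def sum.distrib[symmetric] sum_mono)
  moreover have "\<tau> \<bullet> z = f \<bullet> v + \<tau> \<bullet> B g"
    using B v \<tau> by (simp add: z_def linear_add inner_add_right admissible_stresses_def)
  ultimately show ?thesis
    by (simp add: energy_def dual_energy_def z_def inner_add_right)
qed

text \<open>Beyond \<open>dp\<close> the relaxed density is a quadratic with positive leading
  coefficient and absorbs the linear term; on \<open>{0..dp}\<close> it is bounded below.\<close>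

lemma bdd_above_conj_regularize:
  assumes \<phi>: "\<And>t. 0 \<le> t \<Longrightarrow> 0 \<le> \<phi> t" and \<phi>': "\<phi>' dm > 0" "\<phi>' dp > 0" and d: "0 < dm" "dm \<le> dp"
  shows "bdd_above ((\<lambda>s. r * s - regularize \<phi> \<phi>' dm dp s) ` {0..})"
proof (rule bdd_aboveI2)
  define a where "a = \<phi>' dp / (2 * dp)"
  define k where "k = \<bar>\<phi> dm - dm / 2 * \<phi>' dm\<bar> + \<bar>\<phi> dp - dp / 2 * \<phi>' dp\<bar>"
  have a: "a > 0" using \<phi>' d by (simp add: a_def)
  fix s :: real assume "s \<in> {0..}"
  then have s: "0 \<le> s" by simp
  have k: "0 \<le> k" "- k \<le> \<phi> dm - dm / 2 * \<phi>' dm" "- k \<le> \<phi> dp - dp / 2 * \<phi>' dp"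
    unfolding k_def by linarith+
  have quot: "0 \<le> r\<^sup>2 / (4 * a)" using a by simp
  have nonneg: "0 \<le> \<bar>r\<bar> * dp" using d by simp
  \<comment> \<open>The bound adds the contributions of both cases:
    \<open>\<bar>r\<bar> * dp\<close> from the bounded interval, \<open>r\<^sup>2 / (4 * a)\<close>
    from the quadratic tail, and \<open>k\<close> for the constants of both quadratic
    pieces.\<close>
  have "r * s - regularize \<phi> \<phi>' dm dp s \<le> \<bar>r\<bar> * dp + k + r\<^sup>2 / (4 * a)"
  proof (cases "s \<le> dp")
    case True
    have "r * s \<le> \<bar>r\<bar> * dp"
      using True s by (intro mult_mono) auto
    moreover have "- k \<le> regularize \<phi> \<phi>' dm dp s"
    proof -
      have "0 \<le> \<phi>' dm / (2 * dm) * s\<^sup>2" using \<phi>' d by simp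
      then show ?thesis using k True \<phi>[OF s] by (simp add: regularize_def)
    qed
    ultimately show ?thesis using quot by linarith
  next
    case False
    have "regularize \<phi> \<phi>' dm dp s = a * s\<^sup>2 + (\<phi> dp - dp / 2 * \<phi>' dp)"
      using False d by (simp add: regularize_def a_def)
    \<comment> \<open>Young's inequality, obtained by completing the square.\<close>
    moreover have "r * s \<le> a * s\<^sup>2 + r\<^sup>2 / (4 * a)"
    proof -
      have "0 \<le> (2 * a * s - r)\<^sup>2 / (4 * a)" using a by simp
      also have "\<dots> = a * s\<^sup>2 - r * s + r\<^sup>2 / (4 * a)"
        using a by (simp add: power2_eq_square field_simps)
      finally show ?thesis by simp
    qed
    ultimately show ?thesis using k nonneg by linarith
  qed
  then show "r * s - regularize \<phi> \<phi>' dm dp s \<le> \<bar>r\<bar> * dp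
      + (\<bar>\<phi> dm - dm / 2 * \<phi>' dm\<bar> + \<bar>\<phi> dp - dp / 2 * \<phi>' dp\<bar>) + r\<^sup>2 / (4 * (\<phi>' dp / (2 * dp)))"
    unfolding a_def k_def .
qed

theorem lemma3p14:
  fixes B :: "real^'n \<Rightarrow> real^'m"
    and w :: "'m \<Rightarrow> real"
    and f g u u\<^sub>\<delta> :: "real^'n"
    and \<sigma> :: "real^'m"
    and mc :: nat
    and C :: "nat \<Rightarrow> real^'n"
    and d :: "nat \<Rightarrow> real"
    and \<phi> \<phi>' :: "real \<Rightarrow> real"
    and dm dp :: real
  defines "V\<^sub>0 \<equiv> constraint_kernel mc C"
    and "\<phi>\<^sub>\<delta> \<equiv> regularize \<phi> \<phi>' dm dp"
  assumes "linear B"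
    and "\<And>\<alpha>. w \<alpha> > 0"
    and "\<forall>i<mc. C i \<bullet> g = d i"
    and "{v. B v = 0} \<inter> V\<^sub>0 = {0}"
    and "N_function \<phi> \<phi>'"
    and "\<And>t T. 0 < t \<Longrightarrow> t \<le> T \<Longrightarrow> \<phi>' t / t \<le> \<phi>' T / T"
    and "0 < dm" and "dm \<le> dp"
    and "is_arg_min (\<lambda>v. energy \<phi> w B f (v + g)) (\<lambda>v. v \<in> V\<^sub>0) u"
    and "is_arg_min (\<lambda>v. energy \<phi>\<^sub>\<delta> w B f (v + g)) (\<lambda>v. v \<in> V\<^sub>0) u\<^sub>\<delta>"
    and "is_arg_min (dual_energy \<phi> w B g) (\<lambda>\<tau>. \<tau> \<in> admissible_stresses B f V\<^sub>0) \<sigma>"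
  shows "0 \<le> energy \<phi>\<^sub>\<delta> w B f (u + g) - energy \<phi>\<^sub>\<delta> w B f (u\<^sub>\<delta> + g)
       \<and> energy \<phi>\<^sub>\<delta> w B f (u + g) - energy \<phi>\<^sub>\<delta> w B f (u\<^sub>\<delta> + g)
           \<le> (\<Sum>\<alpha>\<in>UNIV. w \<alpha> * reg_error_conj \<phi> \<phi>' dm dp (inverse (w \<alpha>) * \<bar>\<sigma> $ \<alpha>\<bar>))
             - (\<Sum>\<alpha>\<in>UNIV. w \<alpha> * reg_error \<phi> \<phi>' dm dp \<bar>B (u + g) $ \<alpha>\<bar>)"
proof
  note B = assms(3) and w = assms(4) and N = assms(7)
    and u = assms(11) and u\<^sub>\<delta> = assms(12) and \<sigma> = assms(13)
  have V: "subspace V\<^sub>0"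
    unfolding V\<^sub>0_def by (rule subspace_constraint_kernel)
  show "0 \<le> energy \<phi>\<^sub>\<delta> w B f (u + g) - energy \<phi>\<^sub>\<delta> w B f (u\<^sub>\<delta> + g)"
    using u u\<^sub>\<delta> by (auto simp: is_arg_min_linorder)
  have bdd: "bdd_above ((\<lambda>s. r * s - \<phi>\<^sub>\<delta> s) ` {0..})" for r
    unfolding \<phi>\<^sub>\<delta>_def using N assms(9,10)
    by (intro bdd_above_conj_regularize) (auto simp: N_function_def)
  \<comment> \<open>Admissibility of stresses does not involve the density, so the unrelaxed
    minimizer \<sigma> may be tested against the relaxed energy.\<close>
  have "- (f \<bullet> g) \<le> energy \<phi>\<^sub>\<delta> w B f (u\<^sub>\<delta> + g) + dual_energy \<phi>\<^sub>\<delta> w B g \<sigma>"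
    by (rule weak_duality[OF B w bdd]) (use u\<^sub>\<delta> \<sigma> in \<open>auto simp: is_arg_min_def\<close>)
  moreover have "energy \<phi> w B f (u + g) + dual_energy \<phi> w B g \<sigma> \<le> - (f \<bullet> g)"
    by (rule strong_duality[OF B w V N u \<sigma>])
  \<comment> \<open>The load terms cancel in this difference, as do the terms
    \<open>\<sigma> \<bullet> B g\<close> in the dual one, leaving only pointwise errors.\<close>
  moreover have "energy \<phi> w B f (u + g) - energy \<phi>\<^sub>\<delta> w B f (u + g)
      = (\<Sum>\<alpha>\<in>UNIV. w \<alpha> * reg_error \<phi> \<phi>' dm dp \<bar>B (u + g) $ \<alpha>\<bar>)"
    by (simp add: energy_def reg_error_def \<phi>\<^sub>\<delta>_def right_diff_distrib sum_subtractf)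
  moreover have "dual_energy \<phi>\<^sub>\<delta> w B g \<sigma> - dual_energy \<phi> w B g \<sigma>
      = (\<Sum>\<alpha>\<in>UNIV. w \<alpha> * reg_error_conj \<phi> \<phi>' dm dp (inverse (w \<alpha>) * \<bar>\<sigma> $ \<alpha>\<bar>))"
    by (simp add: dual_energy_def reg_error_conj_def \<phi>\<^sub>\<delta>_def right_diff_distrib sum_subtractf)
  ultimately show "energy \<phi>\<^sub>\<delta> w B f (u + g) - energy \<phi>\<^sub>\<delta> w B f (u\<^sub>\<delta> + g)
      \<le> (\<Sum>\<alpha>\<in>UNIV. w \<alpha> * reg_error_conj \<phi> \<phi>' dm dp (inverse (w \<alpha>) * \<bar>\<sigma> $ \<alpha>\<bar>))
        - (\<Sum>\<alpha>\<in>UNIV. w \<alpha> * reg_error \<phi> \<phi>' dm dp \<bar>B (u + g) $ \<alpha>\<bar>)"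
    by linarith
qed

end
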